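(* The limit \[ c_0=\lim_{k\to\infty}\delta\Big(\bigcup_{2\le b\le k}\mathcal S_b\Big) \] exists, and the set $\mathcal S$ has asymptotic density $\delta(\mathcal S)=c_0$.
   Context: For an integer $b\ge 2$, let $\mathcal S_b=\{ab:\ a\in\mathbb Z,\ a\ge 2,\ a^{ab}\equiv a \pmod{ab}\}$. Let $\mathcal S$ be the set of positive integers $n$ for which there exists a divisor $a$ of $n$ with $1<a<n$ and $a^n\equiv a\pmod n$ (equivalently $\mathcal S=\bigcup_{b\ge2}\mathcal S_b$). For a set $\mathcal A$ of positive integers, $\delta(\mathcal A)$ denotes its asymptotic density, $\lim_{x\to\infty}\#\{n\le x:n\in\mathcal A\}/x$, when it exists. *)

theory Defs
  imports "HOL-Analysis.Analysis" "HOL-Number_Theory.Cong"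
begin

definition S_of :: "nat \<Rightarrow> nat set" where
  "S_of b = {a * b | a. a \<ge> 2 \<and> [a ^ (a * b) = a] (mod (a * b))}"

definition S_all :: "nat set" where
  "S_all = {n. n > 0 \<and> (\<exists>a. a dvd n \<and> 1 < a \<and> a < n \<and> [a ^ n = a] (mod n))}"

definition density_ratio :: "nat set \<Rightarrow> real \<Rightarrow> real" where
  "density_ratio A x = real (card {n \<in> A. n \<ge> 1 \<and> real n \<le> x}) / x"

definition has_density :: "nat set \<Rightarrow> real \<Rightarrow> bool" where
  "has_density A d \<longleftrightarrow> (density_ratio A \<longlongrightarrow> d) at_top"

(* Only meaningful when the limit exists, i.e. when has_density A d for some d. *)
definition asymp_density :: "nat set \<Rightarrow> real" where
  "asymp_density A = Lim at_top (density_ratio A)"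

lemma has_density_imp_asymp_density: "has_density A d \<Longrightarrow> asymp_density A = d"
  unfolding has_density_def asymp_density_def by (intro tendsto_Lim) auto

lemma S_all_eq: "S_all = (\<Union>b\<in>{2..}. S_of b)"
proof (intro set_eqI iffI)
  fix n assume "n \<in> S_all"
  then obtain a where a: "n > 0" "a dvd n" "1 < a" "a < n" "[a ^ n = a] (mod n)"
    by (auto simp: S_all_def)
  then obtain b where b: "n = a * b" by (elim dvdE)
  with a have "b \<noteq> 0" "b \<noteq> 1" by auto
  hence "b \<ge> 2" by simp
  moreover have "n \<in> S_of b"
    unfolding S_of_def using a b by auto
  ultimately show "n \<in> (\<Union>b\<in>{2..}. S_of b)" by auto
next
  fix n assume "n \<in> (\<Union>b\<in>{2..}. S_of b)"
  then obtain a b where "b \<ge> 2" "a \<ge> 2" "n = a * b" "[a ^ n = a] (mod n)"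
    by (auto simp: S_of_def)
  thus "n \<in> S_all"
    unfolding S_all_def by (auto intro!: exI[of _ a])
qed

end

(*
  Each S_b is eventually periodic, so finite unions of the S_b have a density, and it is enough to
  show that the n in S_b with b > k have upper density tending to 0 as k grows.

  Let n = a b be in S_b, that is a^(n-1) = 1 (mod b), and let p be the largest prime factor of b.
  If p <= y, then n has a y-smooth divisor b > k, which is rare because the sum of 1/b over y-smooth b
  converges. If p > y, put m = n/p > 1 and d = ord_p(a). Then d divides both p - 1 and n - 1, hence
  also m - 1. So n = (1 + d i)(1 + d j) with i, j >= 1, which is rare when d is large compared to p.
  If d^16 <= p, then a lies in one of at most p^(1/8) residue classes mod p, and
  - if a >= p, summing 1/(b p) over these classes and over all b with largest prime factor p gives
    O(p^(-11/8));
  - if a < p < a^4, then p a divides n, and summing 1/(p a) gives O(p^(-9/8));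
  - if a^4 <= p, then p is one of the few prime factors of a^d - 1 and is large in terms of a and d.
  All these series converge, and their tails control the counts for every x, without error terms.
*)
theory Submission
  imports Defs "HOL-Number_Theory.Number_Theory" "HOL-Real_Asymp.Real_Asymp"
begin

section \<open>Sets with a uniform counting bound\<close>

text \<open>Upper density is not countably subadditive. An inequality valid for every
  \<open>N\<close>, with no error term, does survive infinite unions, which is what
  \<open>bounded_by_UN\<close> exploits.\<close>

definition bounded_by :: "nat set \<Rightarrow> real \<Rightarrow> bool" where
  "bounded_by A e \<longleftrightarrow> (\<forall>N. real (card (A \<inter> {1..N})) \<le> e * real N)"

lemma bounded_by_mono: "bounded_by B e \<Longrightarrow> A \<subseteq> B \<Longrightarrow> e \<le> e' \<Longrightarrow> bounded_by A e'"
  unfolding bounded_by_def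
proof safe
  fix N assume *: "\<forall>N. real (card (B \<inter> {1..N})) \<le> e * real N" "A \<subseteq> B" "e \<le> e'"
  have "card (A \<inter> {1..N}) \<le> card (B \<inter> {1..N})"
    by (rule card_mono) (use * in auto)
  also have "real \<dots> \<le> e * N" using * by blast
  also have "\<dots> \<le> e' * N" using * by (intro mult_right_mono) auto
  finally show "real (card (A \<inter> {1..N})) \<le> e' * real N" by simp
qed

lemma bounded_by_Un:
  assumes "bounded_by A e" "bounded_by B e'"
  shows "bounded_by (A \<union> B) (e + e')"
  unfolding bounded_by_def
proof
  fix N
  have "card ((A \<union> B) \<inter> {1..N}) \<le> card (A \<inter> {1..N}) + card (B \<inter> {1..N})"
    unfolding Int_Un_distrib2 by (rule card_Un_le)
  moreover have "real (card (A \<inter> {1..N})) \<le> e * N" "real (card (B \<inter> {1..N})) \<le> e' * N"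
    using assms unfolding bounded_by_def by blast+
  ultimately show "real (card ((A \<union> B) \<inter> {1..N})) \<le> (e + e') * N"
    by (simp add: distrib_right)
qed

text \<open>The index set may be infinite. Since an index never exceeds a positive member of its
  set, only indices up to \<open>N\<close> contribute to the count up to \<open>N\<close>, so bounds
  on finite partial sums of the weights suffice.\<close>

lemma bounded_by_UN:
  assumes "\<And>i. i \<in> I \<Longrightarrow> bounded_by (A i) (w i)"
    and "\<And>i n. i \<in> I \<Longrightarrow> n \<in> A i \<Longrightarrow> 1 \<le> n \<Longrightarrow> i \<le> n"
    and "\<And>F. finite F \<Longrightarrow> F \<subseteq> I \<Longrightarrow> sum w F \<le> e"
  shows "bounded_by (\<Union>i\<in>I. A i) e"
  unfolding bounded_by_def
proof
  fix N :: nat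
  define F where "F = I \<inter> {..N}"
  have "(\<Union>i\<in>I. A i) \<inter> {1..N} \<subseteq> (\<Union>i\<in>F. A i \<inter> {1..N})"
    using assms(2) unfolding F_def by fastforce
  then have "card ((\<Union>i\<in>I. A i) \<inter> {1..N}) \<le> card (\<Union>i\<in>F. A i \<inter> {1..N})"
    by (intro card_mono) (auto simp: F_def)
  also have "\<dots> \<le> (\<Sum>i\<in>F. card (A i \<inter> {1..N}))"
    by (rule card_UN_le) (simp add: F_def)
  also have "real \<dots> = (\<Sum>i\<in>F. real (card (A i \<inter> {1..N})))" by simp
  also have "\<dots> \<le> (\<Sum>i\<in>F. w i * real N)"
    using assms(1) unfolding bounded_by_def F_def by (intro sum_mono) blast
  also have "\<dots> = sum w F * N" by (simp add: sum_distrib_right)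
  also have "\<dots> \<le> e * N" using assms(3)[of F] by (intro mult_right_mono) (auto simp: F_def)
  finally show "real (card ((\<Union>i\<in>I. A i) \<inter> {1..N})) \<le> e * real N" by simp
qed

lemma bounded_by_finite_UN:
  assumes "finite I" "\<And>i. i \<in> I \<Longrightarrow> bounded_by (A i) w"
    and "\<And>i n. i \<in> I \<Longrightarrow> n \<in> A i \<Longrightarrow> 1 \<le> n \<Longrightarrow> i \<le> n" "0 \<le> w"
  shows "bounded_by (\<Union>i\<in>I. A i) (real (card I) * w)"
proof (rule bounded_by_UN[where w = "\<lambda>_. w"])
  fix F assume "F \<subseteq> I"
  then have "real (card F) * w \<le> real (card I) * w"
    using assms(1,4) by (intro mult_right_mono) (auto intro: card_mono)
  then show "(\<Sum>i\<in>F. w) \<le> real (card I) * w" by simp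
qed (use assms(2,3) in auto)

text \<open>Starting at j = 1 is essential: there are at most N div m admissible j, and N div m <= N
  / m. Allowing j = 0 would add an error term 1.\<close>

lemma bounded_by_progression:
  assumes "1 \<le> m" "\<And>n. n \<in> A \<Longrightarrow> 1 \<le> n \<Longrightarrow> \<exists>j\<ge>1. n = f j" "\<And>j. m * j \<le> f j"
  shows "bounded_by A (1 / real m)"
  unfolding bounded_by_def
proof
  fix N
  have "A \<inter> {1..N} \<subseteq> f ` {1..N div m}"
  proof
    fix n assume n: "n \<in> A \<inter> {1..N}"
    then obtain j where j: "j \<ge> 1" "n = f j" using assms(2) by auto
    then have "m * j \<le> N" using assms(3)[of j] n by auto
    then have "j \<le> N div m" using assms(1) by (simp add: less_eq_div_iff_mult_less_eq mult.commute)
    then show "n \<in> f ` {1..N div m}" using j by auto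
  qed
  then have "card (A \<inter> {1..N}) \<le> card {1..N div m}"
    by (rule surj_card_le[rotated]) simp
  also have "\<dots> = N div m" by simp
  also have "real \<dots> \<le> real N / real m" by (rule of_nat_div_le_of_nat)
  finally show "real (card (A \<inter> {1..N})) \<le> 1 / real m * real N" by simp
qed

lemma bounded_by_multiples: "1 \<le> m \<Longrightarrow> bounded_by {n. m dvd n} (1 / real m)"
  by (rule bounded_by_progression[where f = "\<lambda>j. m * j"]) (auto elim!: dvdE)

text \<open>The tail estimate is put in terms of finite sets to match the last hypothesis of
  \<open>bounded_by_UN\<close>.\<close>

lemma summable_tail_small:
  fixes f :: "nat \<Rightarrow> real"
  assumes "summable f" "\<And>n. 0 \<le> f n" "0 < e"
  shows "\<exists>M. \<forall>F. finite F \<longrightarrow> F \<subseteq> {M..} \<longrightarrow> sum f F \<le> e"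
proof -
  obtain M where M: "\<And>m n. m \<ge> M \<Longrightarrow> norm (sum f {m..<n}) < e"
    using assms(1,3) unfolding summable_Cauchy by blast
  have "sum f F \<le> e" if F: "finite F" "F \<subseteq> {M..}" for F
  proof -
    have "sum f F \<le> sum f {M..<Suc (Max F)}"
      using F assms(2) by (intro sum_mono2) (auto simp: less_Suc_eq_le)
    also have "\<dots> \<le> e" using M[of M "Suc (Max F)"] by simp
    finally show ?thesis .
  qed
  then show ?thesis by blast
qed

section \<open>Reciprocal sums over smooth numbers\<close>

definition smooth :: "nat \<Rightarrow> nat set" where
  "smooth y = {b. 1 \<le> b \<and> (\<forall>q. prime q \<longrightarrow> q dvd b \<longrightarrow> q \<le> y)}"

text \<open>A new prime p = y + 1 contributes the Euler factor p / (p - 1) = 1 + 1 / y. Instead of a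
  geometric series, split F into non-multiples of p, with sum at most c, and p times a set F1 to
  which the same bound applies inductively; then c + c (1 + 1 / y) / p = c + c / y.\<close>

lemma smooth_sum_prime:
  fixes c :: real
  assumes c: "\<And>F. finite F \<Longrightarrow> F \<subseteq> smooth y \<Longrightarrow> (\<Sum>b\<in>F. 1 / real b) \<le> c"
    and p: "prime (Suc y)" and F: "finite F" "F \<subseteq> smooth (Suc y)"
  shows "(\<Sum>b\<in>F. 1 / real b) \<le> c * (1 + 1 / real y)"
proof -
  define p where "p = Suc y"
  have p2: "p \<ge> 2" "prime p" using p prime_ge_2_nat[OF p] by (simp_all add: p_def)
  have "F \<subseteq> {..M} \<Longrightarrow> finite F \<Longrightarrow> F \<subseteq> smooth p \<Longrightarrow> (\<Sum>b\<in>F. 1 / real b) \<le> c * (1 + 1 / real y)" for M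
  \<comment> \<open>Dividing by p at least halves the elements, so F1 is covered by the induction
    hypothesis for \<open>M div 2\<close>.\<close>
  proof (induction M arbitrary: F rule: less_induct)
    case (less M)
    define F0 where "F0 = {b\<in>F. \<not> p dvd b}"
    define F1 where "F1 = {b. p * b \<in> F}"
    have F: "F = F0 \<union> (*) p ` F1" by (auto simp: F0_def F1_def elim!: dvdE)
    have inj: "inj_on ((*) p) A" for A using p2 by (auto simp: inj_on_def)
    have "finite ((*) p ` F1)"
      using less.prems(2) by (rule finite_subset[rotated]) (auto simp: F1_def)
    then have fin1: "finite F1" by (rule finite_imageD[OF _ inj])
    have fin: "finite F0" "finite F1" using less.prems(2) fin1 by (simp_all add: F0_def)
    have "F0 \<subseteq> smooth y"
      using less.prems(3) unfolding F0_def smooth_def p_def by (auto simp: le_Suc_eq)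
    then have s0: "(\<Sum>b\<in>F0. 1 / real b) \<le> c" using c fin by blast
    have s1: "(\<Sum>b\<in>F1. 1 / real b) \<le> c * (1 + 1 / real y)"
    proof (cases "F1 = {}")
      case True
      then show ?thesis using c[of "{}"] by auto
    next
      case False
      have sm: "F1 \<subseteq> smooth p"
      proof
        fix b assume "b \<in> F1"
        then have "p * b \<in> smooth p" using less.prems(3) by (auto simp: F1_def)
        then show "b \<in> smooth p" unfolding smooth_def by (auto simp: Suc_le_eq)
      qed
      have "F1 \<subseteq> {..M div 2}"
      proof
        fix b assume "b \<in> F1"
        then have "p * b \<in> F" by (simp add: F1_def)
        then have "p * b \<le> M" using less.prems(1) by blast
        moreover have "2 * b \<le> p * b" using p2 by (intro mult_right_mono) auto
        ultimately show "b \<in> {..M div 2}" by (simp only: atMost_iff)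
      qed
      \<comment> \<open>This gives \<open>M div 2 < M\<close>. For M = 0 the only candidate element
        of F1 would be 0, which is not smooth.\<close>
      moreover have "M > 0"
      proof (rule ccontr)
        assume "\<not> M > 0"
        then have "F \<subseteq> {0}" using less.prems(1) by (simp add: subset_eq)
        then have "F1 \<subseteq> {0}" using p2 by (auto simp: F1_def)
        moreover have "0 \<notin> F1" using sm by (auto simp: smooth_def)
        ultimately show False using False by blast
      qed
      ultimately show ?thesis using less.IH[of "M div 2" F1] sm fin by simp
    qed
    have "(\<Sum>b\<in>F. 1 / real b) = (\<Sum>b\<in>F0. 1 / real b) + (\<Sum>b\<in>(*) p ` F1. 1 / real b)"
      by (subst F, rule sum.union_disjoint) (use fin in \<open>auto simp: F0_def\<close>)
    also have "(\<Sum>b\<in>(*) p ` F1. 1 / real b) = (\<Sum>b\<in>F1. 1 / real b) / p"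
      by (subst sum.reindex[OF inj]) (simp add: sum_divide_distrib mult.commute)
    also have "\<dots> \<le> c * (1 + 1 / real y) / p" using s1 by (intro divide_right_mono) auto
    also have "\<dots> = c / y"
    proof -
      have "1 + 1 / real y = real p / real y" "real p \<noteq> 0" using p2 by (auto simp: p_def field_simps)
      then show ?thesis by simp
    qed
    finally show ?case using s0 by (simp add: field_simps)
  qed
  from this[of "Max F"] show ?thesis using F Max_ge[OF F(1)] by (simp add: p_def subset_eq)
qed

lemma smooth_Suc_nonprime: "\<not> prime (Suc y) \<Longrightarrow> smooth (Suc y) = smooth y"
  by (auto simp: smooth_def le_Suc_eq)

lemma smooth_mono: "y \<le> z \<Longrightarrow> smooth y \<subseteq> smooth z"
  by (auto simp: smooth_def)

lemma smooth_1: "smooth 1 = {1}"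
proof -
  have "b = 1" if "b \<in> smooth 1" for b
  proof (rule ccontr)
    assume "b \<noteq> 1"
    then obtain q where "prime q" "q dvd b" using prime_factor_nat by blast
    then show False using that prime_gt_1_nat[of q] by (auto simp: smooth_def)
  qed
  then show ?thesis by (auto simp: smooth_def)
qed

text \<open>Skipping the even numbers above 2 improves the telescoping product over
  \<open>q / (q - 1)\<close> from order \<open>y\<close> to order \<open>sqrt y\<close>; the former would not be summable later.\<close>

lemma smooth_sum_even:
  assumes "finite F" "F \<subseteq> smooth (2 * m + 2)"
  shows "(\<Sum>b\<in>F. 1 / real b) \<le> 2 * sqrt (2 * m + 1)"
  using assms
proof (induction m arbitrary: F)
  \<comment> \<open>The 2-smooth numbers arise from {1} through the prime 2, whose Euler factor is 2
    = 2 * sqrt 1.\<close>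
  case 0
  have "(\<Sum>b\<in>F. 1 / real b) \<le> 1" if "finite F" "F \<subseteq> smooth 1" for F
  proof -
    have "(\<Sum>b\<in>F. 1 / real b) \<le> (\<Sum>b\<in>{1}. 1 / real b)"
      using that unfolding smooth_1 by (intro sum_mono2) auto
    then show ?thesis by simp
  qed
  from smooth_sum_prime[where y = 1, OF this _ 0(1)] 0(2) show ?case
    by (simp add: numeral_2_eq_2[symmetric])
next
  case (Suc m)
  let ?z = "2 * m + 2"
  have np: "\<not> prime (Suc (Suc ?z))"
  proof
    assume "prime (Suc (Suc ?z))"
    moreover have "2 dvd Suc (Suc ?z)" by simp
    ultimately have "2 = Suc (Suc ?z)" using primes_dvd_imp_eq two_is_prime_nat by blast
    then show False by simp
  qed
  have "F \<subseteq> smooth (Suc ?z)" using Suc.prems smooth_Suc_nonprime[OF np] by (simp add: algebra_simps)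
  show ?case
  proof (cases "prime (Suc ?z)")
    case True
    have "(\<Sum>b\<in>F. 1 / real b) \<le> 2 * sqrt (2 * m + 1) * (1 + 1 / real ?z)"
      using smooth_sum_prime[OF Suc.IH True] \<open>F \<subseteq> smooth (Suc ?z)\<close> Suc.prems(1) by blast
    \<comment> \<open>With t = 2 m + 2 this is sqrt (t - 1) * (t + 1) / t <= sqrt (t + 1), which
      after squaring reduces to (t - 1) (t + 1) <= t^2.\<close>
    moreover have "sqrt (2 * m + 1) * (1 + 1 / real ?z) \<le> sqrt (2 * m + 3)"
    proof (rule power2_le_imp_le)
      define t where "t = real ?z"
      have t: "real (2 * m + 1) = t - 1" "real (2 * m + 3) = t + 1" "t \<ge> 2" by (simp_all add: t_def)
      have "(sqrt (2 * m + 1) * (1 + 1 / real ?z))\<^sup>2 = (t - 1) * ((t + 1) / t)\<^sup>2"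
        unfolding t_def[symmetric] t(1) using t(3) by (simp add: power_mult_distrib add_divide_distrib)
      also have "\<dots> = ((t - 1) * (t + 1) / t\<^sup>2) * (t + 1)"
        by (simp add: power_divide power2_eq_square)
      also have "\<dots> \<le> 1 * (t + 1)"
        using t(3) by (intro mult_right_mono) (simp_all add: power2_eq_square algebra_simps)
      also have "\<dots> = 2 * m + 3" using t(2) by simp
      finally show "(sqrt (2 * m + 1) * (1 + 1 / real ?z))\<^sup>2 \<le> (sqrt (2 * m + 3))\<^sup>2" by simp
    qed simp
    ultimately have "(\<Sum>b\<in>F. 1 / real b) \<le> 2 * sqrt (2 * m + 3)"
      by linarith
    then show ?thesis by (simp add: algebra_simps)
  next
    case False
    then have "F \<subseteq> smooth ?z" using smooth_Suc_nonprime \<open>F \<subseteq> smooth (Suc ?z)\<close> by blast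
    then have "(\<Sum>b\<in>F. 1 / real b) \<le> 2 * sqrt (2 * m + 1)" using Suc by blast
    also have "\<dots> \<le> 2 * sqrt (2 * Suc m + 1)" by simp
    finally show ?thesis by simp
  qed
qed

lemma smooth_sum:
  assumes "finite F" "F \<subseteq> smooth y" "1 \<le> y"
  shows "(\<Sum>b\<in>F. 1 / real b) \<le> 2 * sqrt y"
proof -
  \<comment> \<open>Here 2 m + 2 is y rounded up to an even number.\<close>
  define m where "m = (y - 1) div 2"
  have "y \<le> 2 * m + 2" "2 * m + 1 \<le> y" using assms(3) by (auto simp: m_def)
  then have "(\<Sum>b\<in>F. 1 / real b) \<le> 2 * sqrt (2 * m + 1)"
    using assms smooth_mono by (intro smooth_sum_even) blast+
  also have "\<dots> \<le> 2 * sqrt y" using \<open>2 * m + 1 \<le> y\<close> by simp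
  finally show ?thesis .
qed

lemma summable_smooth: "1 \<le> y \<Longrightarrow> summable (\<lambda>b. if b \<in> smooth y then 1 / real b else 0)"
proof (rule summableI_nonneg_bounded[where x = "2 * sqrt y"])
  fix n assume "1 \<le> y"
  have "(\<Sum>b<n. if b \<in> smooth y then 1 / real b else 0) = (\<Sum>b\<in>{..<n} \<inter> smooth y. 1 / real b)"
    by (simp add: sum.inter_restrict)
  also have "\<dots> \<le> 2 * sqrt y" using \<open>1 \<le> y\<close> by (intro smooth_sum) auto
  finally show "(\<Sum>b<n. if b \<in> smooth y then 1 / real b else 0) \<le> 2 * sqrt y" .
qed auto

lemma smooth_multiples_small:
  assumes "1 \<le> y" "0 < e"
  obtains k where "bounded_by (\<Union>b\<in>{b\<in>smooth y. k < b}. {n. b dvd n}) e"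
proof -
  obtain M where M: "\<And>F. finite F \<Longrightarrow> F \<subseteq> {M..} \<Longrightarrow> (\<Sum>b\<in>F. if b \<in> smooth y then 1 / real b else 0) \<le> e"
  proof -
    have "0 \<le> (if n \<in> smooth y then 1 / real n else 0)" for n by simp
    from summable_tail_small[OF summable_smooth[OF assms(1)] this assms(2)] show ?thesis
      using that by blast
  qed
  have "bounded_by (\<Union>b\<in>{b\<in>smooth y. M < b}. {n. b dvd n}) e"
  proof (rule bounded_by_UN[where w = "\<lambda>b. 1 / real b"])
    fix F assume F: "finite F" "F \<subseteq> {b\<in>smooth y. M < b}"
    then have "(\<Sum>b\<in>F. 1 / real b) = (\<Sum>b\<in>F. if b \<in> smooth y then 1 / real b else 0)"
      by (intro sum.cong) auto
    also have "\<dots> \<le> e" using F by (intro M) auto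
    finally show "(\<Sum>b\<in>F. 1 / real b) \<le> e" .
  next
    fix b assume "b \<in> {b\<in>smooth y. M < b}"
    then show "bounded_by {n. b dvd n} (1 / real b)" by (intro bounded_by_multiples) (simp add: smooth_def)
  next
    fix b n :: nat assume "n \<in> {n. b dvd n}" "1 \<le> n"
    then show "b \<le> n" by (simp add: dvd_imp_le)
  qed
  then show ?thesis by (rule that)
qed

section \<open>The four exceptional sets for a large prime factor\<close>

definition small_ord :: "nat \<Rightarrow> nat set" where
  "small_ord p = {r. \<exists>d\<ge>1. d ^ 16 \<le> p \<and> [r ^ d = 1] (mod p)}"

lemma of_nat_power_powr_inverse:
  fixes d k :: nat
  assumes "0 < k"
  shows "real (d ^ k) powr (1 / real k) = real d"
proof (cases "d = 0")
  case False
  then have "real (d ^ k) = real d powr real k" by (simp add: powr_realpow)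
  then show ?thesis using assms by (simp only: powr_powr) simp
qed (use assms in simp)

text \<open>The congruence x^d = 1 has at most d roots modulo a prime, and there are at most
  p^(1/16) exponents d, each at most p^(1/16).\<close>

lemma card_small_ord:
  assumes "prime p"
  shows "real (card (small_ord p \<inter> {..<p})) \<le> real p powr (1/8)"
proof -
  define D where "D = {d::nat. 1 \<le> d \<and> d ^ 16 \<le> p}"
  have le: "real d \<le> real p powr (1/16)" if "d \<in> D" for d
  proof -
    have "real (d ^ 16) \<le> real p" using that unfolding D_def by (simp del: of_nat_power)
    then have "real (d ^ 16) powr (1/16) \<le> real p powr (1/16)" by (intro powr_mono2) simp_all
    then show ?thesis using of_nat_power_powr_inverse[of 16 d] by simp
  qed
  define M where "M = nat \<lfloor>real p powr (1/16)\<rfloor>"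
  have M: "real M \<le> real p powr (1/16)" unfolding M_def by simp
  have DM: "D \<subseteq> {1..M}" using le by (auto simp: D_def M_def le_nat_floor)
  have "small_ord p \<inter> {..<p} \<subseteq> (\<Union>d\<in>D. {x\<in>{..<p}. [x ^ d = 1] (mod p)})"
    by (auto simp: small_ord_def D_def)
  then have "card (small_ord p \<inter> {..<p}) \<le> card (\<Union>d\<in>D. {x\<in>{..<p}. [x ^ d = 1] (mod p)})"
    using DM by (intro card_mono) (auto intro: finite_subset)
  also have "\<dots> \<le> (\<Sum>d\<in>D. card {x\<in>{..<p}. [x ^ d = 1] (mod p)})"
    using DM by (intro card_UN_le) (auto intro: finite_subset)
  also have "\<dots> \<le> (\<Sum>d\<in>D. d)"
    using assms by (intro sum_mono roots_mod_prime_bound) (auto simp: D_def)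
  also have "\<dots> \<le> (\<Sum>d\<in>{1..M}. M)"
    using DM by (intro order.trans[OF sum_mono sum_mono2]) auto
  also have "real \<dots> = real M * real M" by simp
  also have "\<dots> \<le> real p powr (1/16) * real p powr (1/16)"
    using M by (intro mult_mono) auto
  also have "\<dots> = real p powr (1/8)" by (simp flip: powr_add)
  finally show ?thesis by simp
qed

text \<open>Here \<open>g\<close> is the order \<open>d\<close>. Requiring \<open>j \<ge> 1\<close>, i.e. \<open>m > 1\<close>, is what makes the count of \<open>n \<le> N\<close>
  at most \<open>N / (g\<^sup>2 i)\<close> with no error term; likewise \<open>p \<le> a\<close> below.\<close>

definition large_order_part :: "nat \<Rightarrow> nat set" where
  "large_order_part G = (\<Union>g\<in>{G..}. \<Union>i\<in>{1..g ^ 16}. {(1 + g * i) * (1 + g * j) | j. 1 \<le> j})"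


text \<open>The two conditions on \<open>b\<close> together say that p is its largest prime
  factor.\<close>

definition large_cofactor_part :: "nat \<Rightarrow> nat set" where
  "large_cofactor_part y = (\<Union>p\<in>{p. prime p \<and> y < p}. \<Union>b\<in>{b\<in>smooth p. p dvd b}.
     \<Union>r\<in>small_ord p \<inter> {..<p}. {a * b | a. p \<le> a \<and> a mod p = r})"

definition medium_cofactor_part :: "nat \<Rightarrow> nat set" where
  "medium_cofactor_part y = (\<Union>p\<in>{p. prime p \<and> y < p}.
     \<Union>a\<in>{a\<in>small_ord p \<inter> {..<p}. p < a ^ 4}. {n. p * a dvd n})"

text \<open>The union runs over a and d before p because, once these are fixed, p is confined to the
  few prime factors of a^d - 1.\<close>

definition small_cofactor_part :: "nat \<Rightarrow> nat set" where
  "small_cofactor_part y = (\<Union>a\<in>{2..}. \<Union>d\<in>{1..}.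
     \<Union>p\<in>{p \<in> prime_factors (a ^ d - 1). a ^ 4 \<le> p \<and> d ^ 16 \<le> p \<and> y < p}. {n. p dvd n})"

section \<open>Uniform bounds for the four exceptional sets\<close>

text \<open>The product exceeds g^2 i j, so each pair (g, i) costs 1 / (g^2 i). The harmonic sum
  over i <= g^16 is only logarithmic in g, leaving a convergent series of order ln g / g^2.\<close>

lemma small_large_order_part:
  assumes "0 < e"
  obtains G where "1 \<le> G" "bounded_by (large_order_part G) e"
proof -
  define f where "f = (\<lambda>g::nat. (1 + 16 * ln (real g)) / real g ^ 2)"
  have "summable f"
  proof (rule summable_comparison_test_bigo)
    show "summable (\<lambda>g. norm (real g powr (-3/2)))" by (simp add: summable_real_powr_iff)
    show "f \<in> O(\<lambda>g. real g powr (-3/2))" unfolding f_def by real_asymp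
  qed
  \<comment> \<open>At n = 0 division by zero makes the value 0.\<close>
  moreover have "0 \<le> f n" for n by (cases "n = 0") (auto simp: f_def)
  ultimately obtain M where M: "\<And>F. finite F \<Longrightarrow> F \<subseteq> {M..} \<Longrightarrow> sum f F \<le> e"
    using summable_tail_small[of f e] assms by blast
  define G where "G = max 1 M"
  have "bounded_by (large_order_part G) e"
    unfolding large_order_part_def
  proof (rule bounded_by_UN[where w = f])
    fix g assume g: "g \<in> {G..}"
    then have g1: "g \<ge> 1" by (auto simp: G_def)
    show "bounded_by (\<Union>i\<in>{1..g ^ 16}. {(1 + g * i) * (1 + g * j) | j. 1 \<le> j}) (f g)"
    proof (rule bounded_by_UN[where w = "\<lambda>i. 1 / real (g * i * g)"])
      fix i assume i: "i \<in> {1..g ^ 16}"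
      show "bounded_by {(1 + g * i) * (1 + g * j) | j. 1 \<le> j} (1 / real (g * i * g))"
      proof (rule bounded_by_progression[where f = "\<lambda>j. (1 + g * i) * (1 + g * j)"])
        show "1 \<le> g * i * g" using i g1 by simp
        show "g * i * g * j \<le> (1 + g * i) * (1 + g * j)" for j by (simp add: algebra_simps)
      qed auto
    next
      fix i n assume "i \<in> {1..g ^ 16}" "n \<in> {(1 + g * i) * (1 + g * j) | j. 1 \<le> j}"
      then obtain j where j: "n = (1 + g * i) * (1 + g * j)" by blast
      have "i \<le> g * i" using g1 by simp
      also have "\<dots> \<le> n" by (simp add: j algebra_simps)
      finally show "i \<le> n" .
    next
      fix F assume F: "finite F" "F \<subseteq> {1..g ^ 16}"
      have "(\<Sum>i\<in>F. 1 / real (g * i * g)) = (\<Sum>i\<in>F. inverse (real i)) / real g ^ 2"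
        by (simp add: sum_divide_distrib power2_eq_square field_simps)
      also have "(\<Sum>i\<in>F. inverse (real i)) \<le> harm (g ^ 16)"
        unfolding harm_def using F by (intro sum_mono2) auto
      \<comment> \<open>The sequence harm n - ln n is decreasing and equals 1 at n = 1.\<close>
      also have "harm (g ^ 16) \<le> 1 + ln (real (g ^ 16))"
        using euler_mascheroni_sequence_decreasing[of 1 "g ^ 16"] g1 by (simp add: harm_def)
      also have "\<dots> = 1 + 16 * ln (real g)" using g1 by (simp add: ln_realpow)
      finally show "(\<Sum>i\<in>F. 1 / real (g * i * g)) \<le> f g" by (simp add: f_def divide_right_mono)
    qed
  next
    fix g n assume "g \<in> {G..}" "n \<in> (\<Union>i\<in>{1..g ^ 16}. {(1 + g * i) * (1 + g * j) | j. 1 \<le> j})"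
    then obtain i j where ij: "n = (1 + g * i) * (1 + g * j)" "i \<ge> 1" by auto
    have "g \<le> g * i" using ij by simp
    also have "\<dots> \<le> n" by (simp add: ij algebra_simps)
    finally show "g \<le> n" .
  next
    fix F assume "finite F" "F \<subseteq> {G..}"
    then show "sum f F \<le> e" by (intro M) (auto simp: G_def)
  qed
  then show ?thesis by (intro that[of G]) (auto simp: G_def)
qed

lemma powr_tail_small:
  assumes "s < -1" "0 < e" "0 \<le> c"
  shows "\<exists>y. \<forall>F. finite F \<longrightarrow> F \<subseteq> {y..} \<longrightarrow> (\<Sum>p\<in>F. c * real p powr s) \<le> e"
proof (rule summable_tail_small)
  show "summable (\<lambda>p::nat. c * real p powr s)"
    using assms by (intro summable_mult) (simp add: summable_real_powr_iff)
qed (use assms in simp_all)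

text \<open>For fixed p write b = p c with c p-smooth. There are at most p^(1/8) residues, each
  costing 1 / (p b) = 1 / (p^2 c), and the sum of 1 / c is at most 2 sqrt p. The total 2 p^(-11/8)
  is summable.\<close>

lemma small_large_cofactor_part:
  assumes "0 < e"
  shows "\<exists>y. \<forall>z\<ge>y. bounded_by (large_cofactor_part z) e"
proof -
  define f where "f = (\<lambda>p::nat. 2 * real p powr (-11/8))"
  obtain y where y: "\<And>F. finite F \<Longrightarrow> F \<subseteq> {y..} \<Longrightarrow> sum f F \<le> e"
    unfolding f_def using powr_tail_small[of "-11/8" e 2] assms by (simp, blast)
  have "bounded_by (large_cofactor_part z) e" if "y \<le> z" for z
    unfolding large_cofactor_part_def
  proof (rule bounded_by_UN[where w = f])
    fix p assume "p \<in> {p. prime p \<and> z < p}"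
    then have p: "prime p" "p \<ge> 1" using prime_ge_1_nat by auto
    show "bounded_by (\<Union>b\<in>{b\<in>smooth p. p dvd b}. \<Union>r\<in>small_ord p \<inter> {..<p}.
            {a * b | a. p \<le> a \<and> a mod p = r}) (f p)"
    proof (rule bounded_by_UN[where w = "\<lambda>b. real p powr (1/8) * (1 / real (p * b))"])
      fix b assume b: "b \<in> {b\<in>smooth p. p dvd b}"
      then have b1: "b \<ge> 1" by (auto simp: smooth_def)
      have "bounded_by (\<Union>r\<in>small_ord p \<inter> {..<p}. {a * b | a. p \<le> a \<and> a mod p = r})
              (real (card (small_ord p \<inter> {..<p})) * (1 / real (p * b)))"
      proof (rule bounded_by_finite_UN)
        fix r assume "r \<in> small_ord p \<inter> {..<p}"
        show "bounded_by {a * b | a. p \<le> a \<and> a mod p = r} (1 / real (p * b))"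
        \<comment> \<open>The parameter j is a div p, which is at least 1 because p <= a.\<close>
        proof (rule bounded_by_progression[where f = "\<lambda>j. (p * j + r) * b"])
          fix n assume "n \<in> {a * b | a. p \<le> a \<and> a mod p = r}"
          then obtain a where a: "n = a * b" "p \<le> a" "a mod p = r" by blast
          have "a = p * (a div p) + r" using a(3) mult_div_mod_eq by metis
          moreover have "a div p \<ge> 1" using a(2) p by (simp add: div_greater_zero_iff Suc_le_eq)
          ultimately show "\<exists>j\<ge>1. n = (p * j + r) * b" using a(1) by metis
        qed (use p b1 in \<open>auto simp: algebra_simps\<close>)
      next
        fix r n assume "r \<in> small_ord p \<inter> {..<p}" "n \<in> {a * b | a. p \<le> a \<and> a mod p = r}"
        then obtain a where "r < p" "n = a * b" "p \<le> a" by auto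
        moreover have "a \<le> a * b" using b1 by simp
        ultimately show "r \<le> n" by linarith
      qed auto
      then show "bounded_by (\<Union>r\<in>small_ord p \<inter> {..<p}. {a * b | a. p \<le> a \<and> a mod p = r})
              (real p powr (1/8) * (1 / real (p * b)))"
        by (rule bounded_by_mono) (auto intro!: mult_right_mono divide_right_mono card_small_ord p)
    next
      fix F assume F: "finite F" "F \<subseteq> {b\<in>smooth p. p dvd b}"
      define F' where "F' = {c. p * c \<in> F}"
      have FF: "F = (*) p ` F'" using F by (auto simp: F'_def elim!: dvdE)
      have inj: "inj_on ((*) p) A" for A using p by (auto simp: inj_on_def)
      have fin: "finite F'" using F FF finite_imageD inj by blast
      have "F' \<subseteq> smooth p"
      proof
        fix c assume "c \<in> F'"
        then have "p * c \<in> smooth p" using F by (auto simp: F'_def)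
        then show "c \<in> smooth p" unfolding smooth_def by (auto simp: Suc_le_eq)
      qed
      then have s: "(\<Sum>b\<in>F'. 1 / real b) \<le> 2 * sqrt p" using fin p by (intro smooth_sum)
      have "(\<Sum>b\<in>F. real p powr (1/8) * (1 / real (p * b))) =
          real p powr (1/8) / real p ^ 2 * (\<Sum>b\<in>F'. 1 / real b)"
        unfolding FF by (subst sum.reindex[OF inj]) (simp add: sum_distrib_left power2_eq_square mult.assoc)
      also have "\<dots> \<le> real p powr (1/8) / real p ^ 2 * (2 * sqrt p)"
        using s by (intro mult_left_mono) auto
      also have "\<dots> = f p"
      proof -
        have "real p ^ 2 = real p powr 2" "sqrt p = real p powr (1/2)"
          using p by (simp_all add: powr_half_sqrt)
        then have "real p powr (1/8) / real p ^ 2 * (2 * sqrt p)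
           = 2 * (real p powr (1/8) / real p powr 2 * real p powr (1/2))" by simp
        also have "real p powr (1/8) / real p powr 2 * real p powr (1/2) = real p powr (1/8 - 2 + 1/2)"
          by (simp only: powr_add powr_diff)
        finally show ?thesis by (simp add: f_def)
      qed
      finally show "(\<Sum>b\<in>F. real p powr (1/8) * (1 / real (p * b))) \<le> f p" .
    next
      fix b n assume "n \<in> (\<Union>r\<in>small_ord p \<inter> {..<p}. {a * b | a. p \<le> a \<and> a mod p = r})"
      then obtain a where "n = a * b" "p \<le> a" by auto
      then show "b \<le> n" using p by simp
    qed
  next
    fix p n assume p: "p \<in> {p. prime p \<and> z < p}" "1 \<le> n"
      "n \<in> (\<Union>b\<in>{b\<in>smooth p. p dvd b}. \<Union>r\<in>small_ord p \<inter> {..<p}. {a * b | a. p \<le> a \<and> a mod p = r})"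
    then have "p dvd n" by auto
    then show "p \<le> n" using p(2) by (intro dvd_imp_le) auto
  next
    fix F assume "finite F" "F \<subseteq> {p. prime p \<and> z < p}"
    then show "sum f F \<le> e" using that by (intro y) auto
  qed
  then show ?thesis by blast
qed

text \<open>Since a < p, each residue is a single value of a, and p < a^4 gives 1 / (p a) <
  p^(-5/4). At most p^(1/8) values of a leave p^(-9/8).\<close>

lemma small_medium_cofactor_part:
  assumes "0 < e"
  shows "\<exists>y. \<forall>z\<ge>y. bounded_by (medium_cofactor_part z) e"
proof -
  define f where "f = (\<lambda>p::nat. 1 * real p powr (-9/8))"
  obtain y where y: "\<And>F. finite F \<Longrightarrow> F \<subseteq> {y..} \<Longrightarrow> sum f F \<le> e"
    unfolding f_def using powr_tail_small[of "-9/8" e 1] assms by (simp, blast)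
  have "bounded_by (medium_cofactor_part z) e" if "y \<le> z" for z
    unfolding medium_cofactor_part_def
  proof (rule bounded_by_UN[where w = f])
    fix p assume "p \<in> {p. prime p \<and> z < p}"
    then have p: "prime p" "p \<ge> 1" using prime_ge_1_nat by auto
    define A where "A = {a\<in>small_ord p \<inter> {..<p}. p < a ^ 4}"
    have "bounded_by (\<Union>a\<in>A. {n. p * a dvd n}) (real (card A) * real p powr (-5/4))"
    proof (rule bounded_by_finite_UN)
      fix a assume a: "a \<in> A"
      then have a1: "a \<ge> 1" by (cases "a = 0") (auto simp: A_def)
      have "real p powr (1/4) \<le> real (a ^ 4) powr (1/4)"
        using a by (intro powr_mono2) (simp_all add: A_def)
      also have "real (a ^ 4) powr (1/4) = a" using of_nat_power_powr_inverse[of 4 a] by simp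
      finally have "1 / real (p * a) \<le> 1 / (real p * real p powr (1/4))"
        using p a1 by (simp add: frac_le)
      also have "real p * real p powr (1/4) = real p powr (5/4)"
        using p powr_add[of "real p" 1 "1/4"] by simp
      also have "1 / real p powr (5/4) = real p powr (-5/4)"
        using powr_minus_divide[of "real p" "5/4"] by simp
      finally show "bounded_by {n. p * a dvd n} (real p powr (-5/4))"
        using bounded_by_mono[OF bounded_by_multiples[of "p * a"] subset_refl] p a1 by simp
    next
      fix a n assume "a \<in> A" "n \<in> {n. p * a dvd n}" "1 \<le> n"
      then have "a dvd n" "n > 0" by (auto dest: dvd_mult_right)
      then show "a \<le> n" by (rule dvd_imp_le)
    qed (auto simp: A_def)
    moreover have "real (card A) * real p powr (-5/4) \<le> f p"
    proof -
      have "card A \<le> card (small_ord p \<inter> {..<p})" by (intro card_mono) (auto simp: A_def)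
      then have "real (card A) \<le> real p powr (1/8)" using card_small_ord[OF p(1)] by linarith
      then have "real (card A) * real p powr (-5/4) \<le> real p powr (1/8) * real p powr (-5/4)"
        by (intro mult_right_mono) auto
      also have "\<dots> = real p powr (-9/8)" by (simp flip: powr_add)
      finally show ?thesis by (simp add: f_def)
    qed
    ultimately show "bounded_by (\<Union>a\<in>{a\<in>small_ord p \<inter> {..<p}. p < a ^ 4}. {n. p * a dvd n}) (f p)"
      unfolding A_def[symmetric] using bounded_by_mono by blast
  next
    fix p n assume p: "1 \<le> n"
      "n \<in> (\<Union>a\<in>{a\<in>small_ord p \<inter> {..<p}. p < a ^ 4}. {n. p * a dvd n})"
    then have "p dvd n" by (auto dest: dvd_mult_left)
    then show "p \<le> n" using p by (intro dvd_imp_le) auto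
  next
    fix F assume "finite F" "F \<subseteq> {p. prime p \<and> z < p}"
    then show "sum f F \<le> e" using that by (intro y) auto
  qed
  then show ?thesis by blast
qed

text \<open>Every prime power in the factorization of n is at least 2, so n is at least 2 to the
  number of its prime factors.\<close>

lemma card_prime_factors_le:
  fixes n :: nat
  assumes "0 < n" "n \<le> 2 ^ k"
  shows "card (prime_factors n) \<le> k"
proof -
  have "2 ^ card (prime_factors n) = (\<Prod>q\<in>prime_factors n. 2::nat)" by simp
  also have "\<dots> \<le> (\<Prod>q\<in>prime_factors n. q ^ multiplicity q n)"
  proof (intro prod_mono conjI)
    fix q assume q: "q \<in> prime_factors n"
    then have "q \<ge> 2" using in_prime_factors_imp_prime prime_ge_2_nat by blast
    moreover have "multiplicity q n > 0" using q by (simp add: prime_factors_multiplicity)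
    then have "q \<le> q ^ multiplicity q n" using \<open>q \<ge> 2\<close> by (intro self_le_power) auto
    ultimately show "2 \<le> q ^ multiplicity q n" by linarith
  qed simp
  also have "\<dots> = n"
    using assms(1) prod_prime_factors[of n] by simp
  also have "\<dots> \<le> 2 ^ k" by fact
  finally show ?thesis by simp
qed

text \<open>For given a and d there are at most a d primes p, each at least (a d)^3 W. They cost at
  most 1 / (W a^2 d^2) together, and the double sum is at most C^2 / W.\<close>

lemma small_small_cofactor_part:
  assumes "0 < e"
  shows "\<exists>y. \<forall>z\<ge>y. bounded_by (small_cofactor_part z) e"
proof -
  \<comment> \<open>The term at n = 0 is 0, as 1 / 0 = 0.\<close>
  define C where "C = (\<Sum>n. 1 / real n ^ 2)"
  have summ: "summable (\<lambda>n. 1 / real n ^ 2)" 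
    using inverse_power_summable[of 2, where 'a = real] by (simp add: inverse_eq_divide)
  have C: "(\<Sum>n\<in>F. 1 / real n ^ 2) \<le> C" if "finite F" for F
    unfolding C_def using that summ by (intro sum_le_suminf) auto
  have C0: "C \<ge> 0" using C[of "{}"] by simp
  obtain W :: nat where W: "C * C / e < W" using reals_Archimedean2 by blast
  have W0: "W > 0" using W C0 assms by (cases "W = 0") (auto simp: field_simps not_less)
  have CW: "C / W * C \<le> e" using W W0 assms by (simp add: field_simps)
  have "bounded_by (small_cofactor_part z) e" if z: "W ^ 16 \<le> z" for z
    unfolding small_cofactor_part_def
  proof (rule bounded_by_UN[where w = "\<lambda>a. C / W * (1 / real a ^ 2)"])
    fix a :: nat assume a: "a \<in> {2..}"
    show "bounded_by (\<Union>d\<in>{1..}. \<Union>p\<in>{p \<in> prime_factors (a ^ d - 1). a ^ 4 \<le> p \<and> d ^ 16 \<le> p \<and> z < p}.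
       {n. p dvd n}) (C / W * (1 / real a ^ 2))"
    proof (rule bounded_by_UN[where w = "\<lambda>d. 1 / (real W * real a ^ 2) * (1 / real d ^ 2)"])
      fix d :: nat assume d: "d \<in> {1..}"
      define P where "P = {p \<in> prime_factors (a ^ d - 1). a ^ 4 \<le> p \<and> d ^ 16 \<le> p \<and> z < p}"
      have P_ge: "(a * d) ^ 3 * W \<le> p" if p: "p \<in> P" for p
      proof -
        \<comment> \<open>The 16 factors of p^16 are shared out as 12 + 3 + 1, using a^4 <= p, d^16
          <= p and W^16 <= z < p respectively.\<close>
        have "((a * d) ^ 3 * W) ^ 16 = (a ^ 4) ^ 12 * (d ^ 16) ^ 3 * W ^ 16"
          by (simp add: power_mult_distrib flip: power_mult)
        also have "\<dots> \<le> p ^ 12 * p ^ 3 * p"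
          using p z by (intro mult_mono power_mono) (auto simp: P_def)
        also have "\<dots> = p ^ 16" by (simp flip: power_add power_Suc2)
        finally have "((a * d) ^ 3 * W) ^ 16 \<le> p ^ 16" .
        then show ?thesis by (simp add: power_mono_iff)
      qed
      have pos: "(a * d) ^ 3 * W \<ge> 1" using a d W0 by (simp add: Suc_le_eq)
      have "bounded_by (\<Union>p\<in>P. {n. p dvd n}) (real (card P) * (1 / real ((a * d) ^ 3 * W)))"
      proof (rule bounded_by_finite_UN)
        fix p assume p: "p \<in> P"
        have "1 / real p \<le> 1 / real ((a * d) ^ 3 * W)"
        proof (rule divide_left_mono)
          show "real ((a * d) ^ 3 * W) \<le> real p" using P_ge[OF p] by (simp only: of_nat_le_iff)
          have "0 < (a * d) ^ 3 * W" "0 < p" using P_ge[OF p] pos by linarith+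
          then show "0 < real p * real ((a * d) ^ 3 * W)" by (simp only: of_nat_0_less_iff mult_pos_pos)
        qed simp
        then show "bounded_by {n. p dvd n} (1 / real ((a * d) ^ 3 * W))"
          using bounded_by_mono[OF bounded_by_multiples[of p] subset_refl] P_ge[OF p] pos by simp
      qed (auto simp: P_def dest: dvd_imp_le)
      moreover have "real (card P) * (1 / real ((a * d) ^ 3 * W)) \<le> 1 / (real W * real a ^ 2) * (1 / real d ^ 2)"
      proof -
        have "a ^ d \<ge> a" using a d by (intro self_le_power) auto
        then have "0 < a ^ d - 1" using a by simp
        \<comment> \<open>From a <= 2^a; this makes the number of prime factors at most a d.\<close>
        moreover have "a ^ d - 1 \<le> 2 ^ (a * d)"
        proof -
          have "a ^ d \<le> (2 ^ a) ^ d" by (intro power_mono) auto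
          then show ?thesis by (simp add: power_mult)
        qed
        ultimately have "card (prime_factors (a ^ d - 1)) \<le> a * d" by (rule card_prime_factors_le)
        moreover have "card P \<le> card (prime_factors (a ^ d - 1))"
          by (intro card_mono) (auto simp: P_def)
        ultimately have "real (card P) \<le> real a * real d" by (metis of_nat_le_iff of_nat_mult order_trans)
        then have "real (card P) * (1 / real ((a * d) ^ 3 * W)) \<le> real a * real d * (1 / real ((a * d) ^ 3 * W))"
          by (intro mult_right_mono) auto
        also have "\<dots> = 1 / (real W * real a ^ 2) * (1 / real d ^ 2)"
          using a d W0 by (simp add: field_simps power2_eq_square power3_eq_cube)
        finally show ?thesis .
      qed
      ultimately show "bounded_by (\<Union>p\<in>{p \<in> prime_factors (a ^ d - 1). a ^ 4 \<le> p \<and> d ^ 16 \<le> p \<and> z < p}.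
         {n. p dvd n}) (1 / (real W * real a ^ 2) * (1 / real d ^ 2))"
        unfolding P_def[symmetric] using bounded_by_mono by blast
    next
      fix d n :: nat assume n: "1 \<le> n" "d \<in> {1..}"
        "n \<in> (\<Union>p\<in>{p \<in> prime_factors (a ^ d - 1). a ^ 4 \<le> p \<and> d ^ 16 \<le> p \<and> z < p}. {n. p dvd n})"
      then obtain p where p: "d ^ 16 \<le> p" "p dvd n" by auto
      have "d \<le> d ^ 16" using n(2) by (intro self_le_power) auto
      also have "\<dots> \<le> p" by (rule p)
      also have "\<dots> \<le> n" using p n(1) by (intro dvd_imp_le) auto
      finally show "d \<le> n" .
    next
      fix F :: "nat set" assume F: "finite F"
      have "(\<Sum>d\<in>F. 1 / (real W * real a ^ 2) * (1 / real d ^ 2)) =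
          1 / (real W * real a ^ 2) * (\<Sum>d\<in>F. 1 / real d ^ 2)"
        by (simp only: sum_distrib_left)
      also have "\<dots> \<le> 1 / (real W * real a ^ 2) * C"
        using C[OF F] by (intro mult_left_mono) auto
      finally show "(\<Sum>d\<in>F. 1 / (real W * real a ^ 2) * (1 / real d ^ 2)) \<le> C / W * (1 / real a ^ 2)"
        by simp
    qed
  next
    fix a n :: nat assume n: "1 \<le> n" "a \<in> {2..}" "n \<in> (\<Union>d\<in>{1..}.
      \<Union>p\<in>{p \<in> prime_factors (a ^ d - 1). a ^ 4 \<le> p \<and> d ^ 16 \<le> p \<and> z < p}. {n. p dvd n})"
    then obtain p where p: "a ^ 4 \<le> p" "p dvd n" by auto
    have "a \<le> a ^ 4" using n(2) by (intro self_le_power) auto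
    also have "\<dots> \<le> p" by (rule p)
    also have "\<dots> \<le> n" using p n(1) by (intro dvd_imp_le) auto
    finally show "a \<le> n" .
  next
    fix F :: "nat set" assume F: "finite F"
    have "(\<Sum>a\<in>F. C / W * (1 / real a ^ 2)) = C / W * (\<Sum>a\<in>F. 1 / real a ^ 2)"
      by (simp only: sum_distrib_left)
    also have "\<dots> \<le> C / W * C" using C[OF F] C0 by (intro mult_left_mono) auto
    also have "\<dots> \<le> e" by (rule CW)
    finally show "(\<Sum>a\<in>F. C / W * (1 / real a ^ 2)) \<le> e" .
  qed
  then show ?thesis by blast
qed

section \<open>The tail of the union\<close>

text \<open>Cancel the common factor a, which is nonzero since n > 0, from both sides and from the
  modulus a b.\<close>

lemma cong_power_self_iff:
  fixes a b n :: nat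
  assumes "n > 0" "n = a * b"
  shows "[a ^ n = a] (mod n) \<longleftrightarrow> [a ^ (n - 1) = 1] (mod b)"
proof -
  have "a ^ n = a * a ^ (n - 1)" using assms(1) by (cases n) simp_all
  then have "[a ^ n = a] (mod n) \<longleftrightarrow> [a * a ^ (n - 1) = a * 1] (mod n)" by simp
  also have "\<dots> \<longleftrightarrow> [a * a ^ (n - 1) = a * 1] (mod (a * b))" by (simp only: assms(2))
  also have "\<dots> \<longleftrightarrow> [a ^ (n - 1) = 1] (mod b)"
    using assms unfolding cong_def mult_mod_right[symmetric] by simp
  finally show ?thesis .
qed

text \<open>The case distinction for a single n, with p the largest prime factor of b and d the
  order of a modulo p.\<close>

lemma S_of_tail_subset:
  assumes "1 \<le> G" "G ^ 16 \<le> y" "k < b" "n \<in> S_of b"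
  shows "n \<in> (\<Union>b\<in>{b\<in>smooth y. k < b}. {n. b dvd n}) \<union> large_order_part G \<union>
    large_cofactor_part y \<union> medium_cofactor_part y \<union> small_cofactor_part y"
proof -
  obtain a where a: "n = a * b" "a \<ge> 2" "[a ^ n = a] (mod n)"
    using assms(4) by (auto simp: S_of_def)
  have b1: "b \<ge> 1" using assms(3) by simp
  have n1: "n \<ge> 2"
    using a b1 by (metis One_nat_def le_trans mult_le_mono nat_mult_1_right)
  show ?thesis
  proof (cases "b \<in> smooth y")
    case True
    then show ?thesis using a assms(3) by auto
  next
    case False
    define Q where "Q = {q. prime q \<and> q dvd b}"
    have finQ: "finite Q" using b1 by (auto simp: Q_def intro: finite_subset[of _ "{..b}"] dvd_imp_le)
    obtain q where q: "q \<in> Q" "y < q" using False b1 by (auto simp: smooth_def Q_def not_le)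
    \<comment> \<open>As b is not y-smooth, its largest prime factor p exceeds y, while maximality
      makes b p-smooth.\<close>
    define p where "p = Max Q"
    have "p \<in> Q" unfolding p_def using finQ q by (intro Max_in) auto
    then have p: "prime p" "p dvd b" by (auto simp: Q_def)
    have yp: "y < p" using q(2) Max_ge[OF finQ q(1)] unfolding p_def by linarith
    have bs: "b \<in> smooth p" using b1 finQ by (auto simp: smooth_def p_def Q_def)
    have p2: "p \<ge> 2" using p prime_ge_2_nat by blast
    obtain c where c: "b = p * c" using p(2) by blast
    have c1: "c \<ge> 1" using c b1 by (cases c) auto
    have "[a ^ (n - 1) = 1] (mod b)" using cong_power_self_iff[OF _ a(1)] a(3) n1 by simp
    then have cp: "[a ^ (n - 1) = 1] (mod p)" using p(2) cong_dvd_modulus_nat by blast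
    have npa: "\<not> p dvd a"
    proof
      assume "p dvd a"
      then have "p dvd a ^ (n - 1)" using n1 dvd_power[of "n - 1" a] by (auto intro: dvd_trans)
      then have "p dvd 1" using cp cong_dvd_iff by blast
      then show False using p2 by simp
    qed
    define d where "d = ord p a"
    have d1: "d dvd n - 1" using cp by (simp add: d_def ord_divides')
    have d2: "d dvd p - 1" using fermat_theorem[OF p(1) npa] by (simp add: d_def ord_divides')
    have da: "[a ^ d = 1] (mod p)" by (simp add: d_def ord_divides')
    \<comment> \<open>The value 0, which \<open>ord\<close> takes off the coprime case, does not
      divide p - 1 > 0.\<close>
    have d0: "d \<ge> 1" using d2 p2 by (cases d) auto
    define m where "m = a * c"
    have m2: "m \<ge> 2" using a(2) c1 unfolding m_def by (metis le_trans mult.right_neutral mult_le_mono2)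
    have nm: "n = p * m" by (simp add: a(1) c m_def)
    \<comment> \<open>Since d divides n - 1 and p - 1, this identity makes it divide m - 1 as
      well.\<close>
    have "n - 1 = (p - 1) * m + (m - 1)" using p2 m2 by (cases p) (auto simp: nm)
    then have d3: "d dvd m - 1" using d1 d2 by (metis dvd_add_right_iff dvd_mult2)
    obtain i where i: "p - 1 = d * i" using d2 by blast
    obtain j where j: "m - 1 = d * j" using d3 by blast
    have i1: "i \<ge> 1" using i p2 by (cases i) auto
    have j1: "j \<ge> 1" using j m2 by (cases j) auto
    have pe: "p = 1 + d * i" and me: "m = 1 + d * j" using i j p2 m2 by linarith+
    show ?thesis
    proof (cases "d ^ 16 \<le> p")
      case False
      \<comment> \<open>The range of i follows from d i = p - 1 < d^16; next, G^16 <= y < p < d^16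
        yields G <= d.\<close>
      have "i \<le> d * i" using d0 by simp
      also have "\<dots> \<le> d ^ 16" using False pe by linarith
      finally have "i \<in> {1..d ^ 16}" using i1 by simp
      moreover have "G ^ 16 < d ^ 16" using False assms(2) yp by linarith
      then have "G \<le> d" using power_less_imp_less_base by fastforce
      ultimately have "n \<in> large_order_part G"
        using nm pe me j1 unfolding large_order_part_def by blast
      then show ?thesis by blast
    next
      case small: True
      have am: "[(a mod p) ^ d = 1] (mod p)" using da by (simp add: cong_def power_mod)
      have ord: "a mod p \<in> small_ord p \<inter> {..<p}" using am small d0 p2 by (auto simp: small_ord_def)
      consider "p \<le> a" | "a < p" "p < a ^ 4" | "a ^ 4 \<le> p" by linarith
      then show ?thesis
      proof cases
        case 1
        then have "n \<in> large_cofactor_part y"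
          using p yp bs ord a(1) unfolding large_cofactor_part_def by blast
        then show ?thesis by blast
      next
        case 2
        then have "a \<in> {a \<in> small_ord p \<inter> {..<p}. p < a ^ 4}" using ord by simp
        moreover have "p * a dvd n" by (simp add: nm m_def)
        ultimately have "n \<in> medium_cofactor_part y"
          using p yp unfolding medium_cofactor_part_def by blast
        then show ?thesis by blast
      next
        case 3
        have "a ^ d > 1" using a(2) d0 by (intro one_less_power) auto
        moreover have "p dvd a ^ d - 1"
          using da by (rule cong_to_1_nat)
        ultimately have "p \<in> prime_factors (a ^ d - 1)"
          using p(1) by (intro prime_factorsI) auto
        moreover have "p dvd n" by (simp add: nm)
        ultimately have "n \<in> small_cofactor_part y"
          using 3 small yp a(2) d0 unfolding small_cofactor_part_def by blast
        then show ?thesis by blast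
      qed
    qed
  qed
qed

text \<open>The order of choices matters: G first, then y above all thresholds, and only then k,
  which depends on y through the smooth multiples.\<close>

lemma S_of_tail_small:
  assumes "0 < e"
  obtains k where "bounded_by (\<Union>b\<in>{k<..}. S_of b) e"
proof -
  have e: "0 < e / 5" using assms by simp
  obtain G where G: "1 \<le> G" "bounded_by (large_order_part G) (e / 5)"
    by (rule small_large_order_part[OF e])
  obtain y1 where y1: "\<And>z. y1 \<le> z \<Longrightarrow> bounded_by (large_cofactor_part z) (e / 5)"
    using small_large_cofactor_part[OF e] by blast
  obtain y2 where y2: "\<And>z. y2 \<le> z \<Longrightarrow> bounded_by (medium_cofactor_part z) (e / 5)"
    using small_medium_cofactor_part[OF e] by blast
  obtain y3 where y3: "\<And>z. y3 \<le> z \<Longrightarrow> bounded_by (small_cofactor_part z) (e / 5)"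
    using small_small_cofactor_part[OF e] by blast
  define y where "y = G ^ 16 + y1 + y2 + y3"
  have "1 \<le> y" using G(1) by (simp add: y_def Suc_le_eq)
  then obtain k where k: "bounded_by (\<Union>b\<in>{b\<in>smooth y. k < b}. {n. b dvd n}) (e / 5)"
    by (rule smooth_multiples_small[OF _ e])
  have sub: "(\<Union>b\<in>{k<..}. S_of b) \<subseteq> (\<Union>b\<in>{b\<in>smooth y. k < b}. {n. b dvd n}) \<union> large_order_part G \<union>
    large_cofactor_part y \<union> medium_cofactor_part y \<union> small_cofactor_part y"
    using S_of_tail_subset[OF G(1), of y k] by (fastforce simp: y_def)
  have "bounded_by ((\<Union>b\<in>{b\<in>smooth y. k < b}. {n. b dvd n}) \<union> large_order_part G \<union>
    large_cofactor_part y \<union> medium_cofactor_part y \<union> small_cofactor_part y)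
    (e / 5 + e / 5 + e / 5 + e / 5 + e / 5)"
    by (intro bounded_by_Un k G y1 y2 y3) (simp_all add: y_def)
  from this sub have "bounded_by (\<Union>b\<in>{k<..}. S_of b) e"
    by (rule bounded_by_mono) simp
  then show ?thesis by (rule that)
qed

section \<open>Density of eventually periodic sets\<close>

lemma card_periodic_window:
  fixes A :: "nat set"
  assumes per: "\<And>n. n0 \<le> n \<Longrightarrow> n \<in> A \<longleftrightarrow> n + Q \<in> A"
  shows "card (A \<inter> {n0..<n0 + q * Q}) = q * card (A \<inter> {n0..<n0 + Q})"
proof (induction q)
  case (Suc q)
  have per': "n \<in> A \<longleftrightarrow> n + q * Q \<in> A" if "n0 \<le> n" for n q
  proof (induction q)
    case (Suc q)
    then show ?case using per[of "n + q * Q"] that by (simp add: algebra_simps)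
  qed simp
  have "bij_betw (\<lambda>n. n + q * Q) (A \<inter> {n0..<n0 + Q}) (A \<inter> {n0 + q * Q..<n0 + Suc q * Q})"
  proof (rule bij_betwI[where g = "\<lambda>n. n - q * Q"])
    show "(\<lambda>n. n - q * Q) \<in> A \<inter> {n0 + q * Q..<n0 + Suc q * Q} \<rightarrow> A \<inter> {n0..<n0 + Q}"
    proof
      fix n assume n: "n \<in> A \<inter> {n0 + q * Q..<n0 + Suc q * Q}"
      then have "n0 \<le> n - q * Q" "n - q * Q < n0 + Q" "n - q * Q + q * Q = n" by auto
      then show "n - q * Q \<in> A \<inter> {n0..<n0 + Q}" using per'[of "n - q * Q" q] n by auto
    qed
  qed (use per' in auto)
  then have "card (A \<inter> {n0 + q * Q..<n0 + Suc q * Q}) = card (A \<inter> {n0..<n0 + Q})"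
    by (rule bij_betw_same_card[symmetric])
  moreover have "A \<inter> {n0..<n0 + Suc q * Q} = (A \<inter> {n0..<n0 + q * Q}) \<union> (A \<inter> {n0 + q * Q..<n0 + Suc q * Q})"
    by auto
  moreover have "card ((A \<inter> {n0..<n0 + q * Q}) \<union> (A \<inter> {n0 + q * Q..<n0 + Suc q * Q})) =
      card (A \<inter> {n0..<n0 + q * Q}) + card (A \<inter> {n0 + q * Q..<n0 + Suc q * Q})"
    by (rule card_Un_disjoint) auto
  ultimately show ?case using Suc by simp
qed simp

lemma density_ratio_nat: "0 \<le> x \<Longrightarrow> density_ratio A x = real (card (A \<inter> {1..nat \<lfloor>x\<rfloor>})) / x"
  unfolding density_ratio_def
  by (intro arg_cong2[where f = "(/)"] arg_cong[where f = real] arg_cong[where f = card])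
     (auto simp: le_nat_floor le_nat_iff le_floor_iff)

text \<open>The density is c / Q with c the count in one period, because the count up to N differs
  from c N / Q by a bounded amount.\<close>

lemma periodic_has_density:
  fixes A :: "nat set"
  assumes Q: "0 < Q" and per: "\<And>n. n0 \<le> n \<Longrightarrow> n \<in> A \<longleftrightarrow> n + Q \<in> A"
  shows "\<exists>d. has_density A d"
proof -
  define c where "c = card (A \<inter> {n0..<n0 + Q})"
  have "c \<le> card {n0..<n0 + Q}" unfolding c_def by (intro card_mono) auto
  then have cQ: "c \<le> Q" by simp
  \<comment> \<open>{1..N} is compared with N div Q and N div Q + 1 full periods starting at n0; the
    shift by n0 and the incomplete period cost only a constant.\<close>
  have est: "\<bar>real (card (A \<inter> {1..N})) - real c / real Q * real N\<bar> \<le> real (2 * n0 + 2 * Q)" for N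
  proof -
    define q where "q = N div Q"
    have qN: "q * Q \<le> N" "N < q * Q + Q"
      using Q by (auto simp: q_def) (metis add.commute dividend_less_times_div mult.commute)
    have "card (A \<inter> {1..N}) \<le> card ({..<n0} \<union> (A \<inter> {n0..<n0 + Suc q * Q}))"
      using qN by (intro card_mono) auto
    also have "\<dots> \<le> n0 + Suc q * c"
      using card_Un_le[of "{..<n0}" "A \<inter> {n0..<n0 + Suc q * Q}"]
        card_periodic_window[OF per, where q = "Suc q"] by (simp add: c_def)
    finally have "real (card (A \<inter> {1..N})) \<le> real (n0 + Suc q * c)" by (simp only: of_nat_le_iff)
    then have up: "real (card (A \<inter> {1..N})) \<le> real n0 + real q * real c + real c"
      by (simp add: algebra_simps)
    have "q * c = card (A \<inter> {n0..<n0 + q * Q})"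
      using card_periodic_window[OF per, where q = q] by (simp add: c_def)
    \<comment> \<open>The added set absorbs the part of the window outside {1..N}: possibly 0, and
      at most n0 numbers above N.\<close>
    also have "\<dots> \<le> card ((A \<inter> {1..N}) \<union> ({0} \<union> {N<..N + n0}))"
      using qN by (intro card_mono) auto
    also have "\<dots> \<le> card (A \<inter> {1..N}) + card ({0} \<union> {N<..N + n0})" by (rule card_Un_le)
    also have "\<dots> \<le> card (A \<inter> {1..N}) + (1 + n0)"
      using card_Un_le[of "{0}" "{N<..N + n0}"] by simp
    finally have "real (q * c) \<le> real (card (A \<inter> {1..N}) + (1 + n0))" by (simp only: of_nat_le_iff)
    then have lo: "real q * real c \<le> real (card (A \<inter> {1..N})) + 1 + real n0" by simp
    have "real c / Q * (real q * Q) \<le> real c / Q * N"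
      using qN by (intro mult_left_mono) (auto simp flip: of_nat_mult)
    then have 1: "real q * real c \<le> real c / Q * N" using Q by (simp add: mult.commute)
    have "real c / Q * N \<le> real c / Q * (real q * Q + Q)"
      using qN by (intro mult_left_mono) (auto simp flip: of_nat_mult of_nat_add)
    then have 2: "real c / Q * N \<le> real q * real c + real c" using Q by (simp add: distrib_left mult.commute)
    have "real c \<le> real Q" "1 \<le> real Q" "0 \<le> real n0" using cQ Q by simp_all
    then have "\<bar>real (card (A \<inter> {1..N})) - real c / real Q * real N\<bar> \<le> 2 * real n0 + 2 * real Q"
      using up lo 1 2 by linarith
    then show ?thesis by simp
  qed
  have "((\<lambda>x. density_ratio A x - real c / real Q) \<longlongrightarrow> 0) at_top"
  proof (rule Lim_null_comparison)
    show "((\<lambda>x. (real (2 * n0 + 2 * Q) + real c / real Q) / x) \<longlongrightarrow> 0) at_top" by real_asymp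
    show "\<forall>\<^sub>F x in at_top. norm (density_ratio A x - real c / real Q) \<le> (real (2 * n0 + 2 * Q) + real c / real Q) / x"
      using eventually_gt_at_top[of 0]
    proof eventually_elim
      case (elim x)
      define N where "N = nat \<lfloor>x\<rfloor>"
      have N: "real N \<le> x" "x \<le> real N + 1" using elim by (auto simp: N_def)
      have "real c / Q * N \<le> real c / Q * x" "real c / Q * x \<le> real c / Q * (real N + 1)"
        using N by (intro mult_left_mono; simp)+
      then have "\<bar>real c / Q * N - real c / Q * x\<bar> \<le> real c / Q" by (simp add: distrib_left)
      then have "\<bar>real (card (A \<inter> {1..N})) - real c / Q * x\<bar> \<le> real (2 * n0 + 2 * Q) + real c / Q"
        using est[of N] abs_triangle_ineq[of "real (card (A \<inter> {1..N})) - real c / Q * N" "real c / Q * N - real c / Q * x"]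
        by simp
      moreover have "density_ratio A x - real c / Q = (real (card (A \<inter> {1..N})) - real c / Q * x) / x"
        using elim by (simp add: density_ratio_nat N_def diff_divide_distrib)
      ultimately show ?case using elim by (simp add: divide_right_mono)
    qed
  qed
  then have "(density_ratio A \<longlongrightarrow> real c / real Q) at_top" by (rule LIM_zero_cancel)
  then show ?thesis unfolding has_density_def by blast
qed

text \<open>The bound 2 b makes the cofactor n div b at least 2, so membership becomes a congruence
  condition on n alone.\<close>

lemma S_of_iff:
  assumes "b \<ge> 2" "n \<ge> 2 * b"
  shows "n \<in> S_of b \<longleftrightarrow> b dvd n \<and> [(n div b) ^ (n - 1) = 1] (mod b)"
proof -
  have "n > 0" using assms by simp
  note * = cong_power_self_iff[OF this]
  show ?thesis
  proof
    assume "n \<in> S_of b"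
    then obtain a where a: "n = a * b" "[a ^ n = a] (mod n)" by (auto simp: S_of_def)
    moreover have "n div b = a" using a(1) assms(1) by simp
    ultimately show "b dvd n \<and> [(n div b) ^ (n - 1) = 1] (mod b)" using *[OF a(1)] by simp
  next
    assume R: "b dvd n \<and> [(n div b) ^ (n - 1) = 1] (mod b)"
    then have n: "n = n div b * b" by simp
    moreover have "n div b \<ge> 2" using assms by (simp add: less_eq_div_iff_mult_less_eq)
    moreover have "[(n div b) ^ n = n div b] (mod n)" using *[OF n] R by blast
    ultimately show "n \<in> S_of b" unfolding S_of_def
      by (intro CollectI exI[of _ "n div b"]) simp
  qed
qed

text \<open>Divisibility by b^2 preserves n div b modulo b. Divisibility by the totient preserves
  the power of a by Euler's theorem if a is coprime to b; otherwise no positive power of a is 1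
  modulo b, and both sides fail.\<close>

lemma S_of_periodic:
  assumes "b \<ge> 2" "n \<ge> 2 * b" "b * b dvd Q" "totient b dvd Q"
  shows "n \<in> S_of b \<longleftrightarrow> n + Q \<in> S_of b"
proof (cases "b dvd n")
  case True
  then obtain a where a: "n = b * a" by blast
  obtain t where "Q = b * b * t" using assms(3) by blast
  then have t: "Q = b * (b * t)" by (simp only: mult.assoc)
  obtain s where s: "Q = totient b * s" using assms(4) by blast
  have div: "n div b = a" "(n + Q) div b = a + b * t"
    using assms(1) by (simp_all add: a t flip: distrib_left)
  have "[(a + b * t) ^ (n + Q - 1) = a ^ (n + Q - 1)] (mod b)"
    by (intro cong_pow) (simp add: cong_def)
  moreover have "[a ^ (n + Q - 1) = 1] (mod b) \<longleftrightarrow> [a ^ (n - 1) = 1] (mod b)"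
  proof (cases "coprime a b")
    case True
    have "[a ^ Q = 1] (mod b)" using cong_pow[OF euler_theorem[OF True], of s] by (simp add: s power_mult)
    then have "[a ^ (n - 1) * a ^ Q = a ^ (n - 1) * 1] (mod b)" by (intro cong_mult) auto
    moreover have "a ^ (n - 1) * a ^ Q = a ^ (n + Q - 1)" using assms(1,2) by (simp flip: power_add)
    ultimately show ?thesis by (metis cong_sym cong_trans mult.right_neutral)
  next
    case False
    have "\<not> [a ^ k = 1] (mod b)" if "k > 0" for k
    proof
      assume "[a ^ k = 1] (mod b)"
      then have "coprime (a ^ k) b" using cong_imp_coprime cong_sym coprime_1_left by blast
      then show False using False that by simp
    qed
    then show ?thesis using assms(1,2) by simp
  qed
  ultimately have "[(a + b * t) ^ (n + Q - 1) = 1] (mod b) \<longleftrightarrow> [a ^ (n - 1) = 1] (mod b)"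
    using cong_trans cong_sym by blast
  moreover have "b dvd n + Q" by (simp add: a t)
  ultimately show ?thesis using assms True div by (simp add: S_of_iff)
next
  case False
  moreover have "b dvd Q" using assms(3) dvd_mult_left by blast
  ultimately show ?thesis using assms by (simp add: S_of_iff dvd_add_left_iff)
qed

lemma has_density_S_of_UN: "\<exists>d. has_density (\<Union>b\<in>{2..k}. S_of b) d"
proof (rule periodic_has_density)
  \<comment> \<open>A common period for all b up to k, valid from 2 k on.\<close>
  define Q where "Q = (\<Prod>b\<in>{2..k}. b * b * totient b)"
  show "0 < Q" unfolding Q_def by (intro prod_pos) auto
  fix n assume n: "2 * k \<le> n"
  have "n \<in> S_of b \<longleftrightarrow> n + Q \<in> S_of b" if "b \<in> {2..k}" for b
  proof -
    have "b * b * totient b dvd Q" unfolding Q_def using that by (intro dvd_prodI) auto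
    then have "b * b dvd Q" "totient b dvd Q" using dvd_mult_left dvd_mult_right by blast+
    then show ?thesis using that n by (intro S_of_periodic) auto
  qed
  then show "n \<in> (\<Union>b\<in>{2..k}. S_of b) \<longleftrightarrow> n + Q \<in> (\<Union>b\<in>{2..k}. S_of b)" by blast
qed

section \<open>Comparison of density ratios and passage to the limit\<close>

lemma density_ratio_mono:
  assumes "A \<subseteq> B" "0 \<le> x" shows "density_ratio A x \<le> density_ratio B x"
proof -
  have "card (A \<inter> {1..nat \<lfloor>x\<rfloor>}) \<le> card (B \<inter> {1..nat \<lfloor>x\<rfloor>})"
    using assms(1) by (intro card_mono) auto
  then show ?thesis using assms(2) by (simp add: density_ratio_nat divide_right_mono)
qed

lemma density_ratio_bounded_by:
  assumes "B \<subseteq> A \<union> C" "bounded_by C e" "0 < x" "0 \<le> e"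
  shows "density_ratio B x \<le> density_ratio A x + e"
proof -
  define N where "N = nat \<lfloor>x\<rfloor>"
  have N: "real N \<le> x" using assms(3) by (simp add: N_def)
  have "card (B \<inter> {1..N}) \<le> card ((A \<inter> {1..N}) \<union> (C \<inter> {1..N}))"
    using assms(1) by (intro card_mono) auto
  also have "\<dots> \<le> card (A \<inter> {1..N}) + card (C \<inter> {1..N})" by (rule card_Un_le)
  finally have "real (card (B \<inter> {1..N})) \<le> real (card (A \<inter> {1..N})) + real (card (C \<inter> {1..N}))" by simp
  also have "real (card (C \<inter> {1..N})) \<le> e * N" using assms(2) by (simp add: bounded_by_def)
  also have "e * N \<le> e * x" using N assms(4) by (intro mult_left_mono)
  finally have "real (card (B \<inter> {1..N})) / x \<le> (real (card (A \<inter> {1..N})) + e * x) / x"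
    using assms(3) by (intro divide_right_mono) auto
  then show ?thesis using assms(3) by (simp add: density_ratio_nat N_def add_divide_distrib)
qed

lemma density_ratio_le_1: "0 < x \<Longrightarrow> density_ratio A x \<le> 1"
proof -
  assume x: "0 < x"
  have "card (A \<inter> {1..nat \<lfloor>x\<rfloor>}) \<le> card {1..nat \<lfloor>x\<rfloor>}" by (intro card_mono) auto
  then have "real (card (A \<inter> {1..nat \<lfloor>x\<rfloor>})) \<le> real (nat \<lfloor>x\<rfloor>)" by simp
  also have "\<dots> \<le> x" using x by simp
  finally show ?thesis using x by (simp add: density_ratio_nat)
qed

text \<open>The densities of the finite unions increase and are at most 1, hence converge. The ratio
  of \<open>S_all\<close> lies between that of a finite union and the same plus the small tail
  bound, which transfers the limit.\<close>

theorem mainTheorem2: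
  shows "(\<forall>k\<ge>2. \<exists>d. has_density (\<Union>b\<in>{2..k}. S_of b) d) \<and>
         (\<exists>c0. ((\<lambda>k. asymp_density (\<Union>b\<in>{2..k}. S_of b)) \<longlonglongrightarrow> c0) \<and>
               has_density S_all c0)"
proof -
  define A where "A = (\<lambda>k. \<Union>b\<in>{2..k}. S_of b)"
  define d where "d = (\<lambda>k. asymp_density (A k))"
  have d: "(density_ratio (A k) \<longlongrightarrow> d k) at_top" for k
    using has_density_S_of_UN[of k] has_density_imp_asymp_density
    unfolding d_def A_def has_density_def by metis
  have "incseq d"
  proof (rule incseq_SucI)
    fix k
    show "d k \<le> d (Suc k)"
    proof (rule tendsto_le[OF _ d d])
      show "\<forall>\<^sub>F x in at_top. density_ratio (A k) x \<le> density_ratio (A (Suc k)) x"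
        using eventually_ge_at_top[of 0]
      proof eventually_elim
        case (elim x)
        have "A k \<subseteq> A (Suc k)" unfolding A_def by (rule UN_mono) auto
        then show ?case using elim by (rule density_ratio_mono)
      qed
    qed simp
  qed
  moreover have "d k \<le> 1" for k
  proof (rule tendsto_upperbound[OF d])
    show "\<forall>\<^sub>F x in at_top. density_ratio (A k) x \<le> 1"
      using eventually_mono[OF eventually_gt_at_top density_ratio_le_1] .
  qed simp
  ultimately obtain c0 where c0: "d \<longlonglongrightarrow> c0" "\<And>k. d k \<le> c0"
    using incseq_convergent[of d 1] by blast
  have "(density_ratio S_all \<longlongrightarrow> c0) at_top"
  proof (rule tendstoI)
    \<comment> \<open>The three thirds of e pay for the tail b > k, for the distance of d k to c0,
      and for the distance of the ratio of A k to d k.\<close>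
    fix e :: real assume e: "e > 0"
    then have e3: "e / 3 > 0" by simp
    obtain k1 where k1: "bounded_by (\<Union>b\<in>{k1<..}. S_of b) (e / 3)" by (rule S_of_tail_small[OF e3])
    obtain k2 where k2: "\<And>k. k \<ge> k2 \<Longrightarrow> dist (d k) c0 < e / 3"
      using metric_LIMSEQ_D[OF c0(1) e3] by blast
    define k where "k = max k1 k2"
    have tail: "bounded_by (\<Union>b\<in>{k<..}. S_of b) (e / 3)"
      by (rule bounded_by_mono[OF k1]) (auto simp: k_def)
    have "{2..} \<subseteq> {2..k} \<union> {k<..}" by auto
    then have sub: "A k \<subseteq> S_all" "S_all \<subseteq> A k \<union> (\<Union>b\<in>{k<..}. S_of b)"
      unfolding S_all_eq A_def by auto
    have dk: "dist (d k) c0 < e / 3" by (rule k2) (simp add: k_def)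
    show "\<forall>\<^sub>F x in at_top. dist (density_ratio S_all x) c0 < e"
      using tendstoD[OF d e3, of k] eventually_gt_at_top[of 0]
    proof eventually_elim
      case (elim x)
      have "density_ratio (A k) x \<le> density_ratio S_all x"
        using sub(1) elim by (intro density_ratio_mono) auto
      moreover have "density_ratio S_all x \<le> density_ratio (A k) x + e / 3"
        using sub(2) tail elim e by (intro density_ratio_bounded_by) auto
      ultimately show ?case using elim dk unfolding dist_real_def by linarith
    qed
  qed
  then have "has_density S_all c0" by (simp add: has_density_def)
  then show ?thesis using c0(1) has_density_S_of_UN unfolding d_def A_def by blast
qed

end
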